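(* Let $G$ be a finite simple directed graph with at least one edge. The Lie algebra $\mathfrak n_G$ is nonsingular if and only if $G=K_2$, the complete graph on two vertices (ignoring edge direction).
   Context: Construction of $\mathfrak{n}_G$: let $G=(S,E)$ be a finite simple directed graph with at least one edge, with vertex set $S=\{X_1,\dots,X_m\}$ and edge set $E=\{Z_1,\dots,Z_q\}$. Let $\mathcal V$ be the real vector space with basis $S$, $\mathfrak z$ the real vector space with basis $E$, and $\mathfrak n_G=\mathcal V\oplus\mathfrak z$. The Lie bracket is the bilinear skew-symmetric extension of: $[X_i,X_l]=Z_k$ if $Z_k$ is a directed edge from $X_i$ to $X_l$; $[X_i,X_l]=0$ if $X_i,X_l$ are not adjacent; and $[\mathfrak n_G,\mathfrak z]=0$. The inner product is the one making $S\cup E$ orthonormal. For $Z\in\mathfrak z$, the skew-symmetric linear map $j(Z):\mathcal V\to\mathcal V$ is defined by $\langle j(Z)X,Y\rangle=\langle[X,Y],Z\rangle$ for $X,Y\in\mathcal V$. Throughout $\mathfrak z$ and $\mathcal V$ denote these spans of edges and of vertices (also when $G$ has isolated vertices). $\mathfrak n_G$ is nonsingular if $j(Z)$ is nonsingular (invertible) for every nonzero $Z\in\mathfrak z$. *)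

theory Defs
  imports Complex_Main "Graph_Theory.Graph_Theory"
begin

text \<open>
  The locale \<^locale>\<open>digraph\<close> of the library (finite, no loops, no parallel arcs) still admits
  opposite arcs between the same two vertices. These have to be excluded here: with arcs \<open>Z\<close> from
  \<open>X\<close> to \<open>Y\<close> and \<open>Z'\<close> from \<open>Y\<close> to \<open>X\<close>, skew-symmetry would force \<open>Z = [X, Y] = - Z'\<close>.
\<close>

locale simple_directed_graph = digraph +
  assumes no_opposite_arcs: "u \<rightarrow>\<^bsub>G\<^esub> v \<Longrightarrow> \<not> v \<rightarrow>\<^bsub>G\<^esub> u"

text \<open>
  A vector is given by its coordinates with respect to the basis of all vertices (tagged \<open>Inl\<close>)
  and all arcs (tagged \<open>Inr\<close>), and has coordinate 0 at everything outside this basis.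
\<close>

type_synonym ('a, 'b) vec = "'a + 'b \<Rightarrow> real"

definition nG_basis :: "('a, 'b) pre_digraph \<Rightarrow> ('a + 'b) set" where
  "nG_basis G = verts G <+> arcs G"

definition nG :: "('a, 'b) pre_digraph \<Rightarrow> ('a, 'b) vec set" where
  "nG G = {x. \<forall>p. p \<notin> nG_basis G \<longrightarrow> x p = 0}"

definition vertex_space :: "('a, 'b) pre_digraph \<Rightarrow> ('a, 'b) vec set" where
  "vertex_space G = {x. \<forall>p. p \<notin> Inl ` verts G \<longrightarrow> x p = 0}"

definition edge_space :: "('a, 'b) pre_digraph \<Rightarrow> ('a, 'b) vec set" where
  "edge_space G = {x. \<forall>p. p \<notin> Inr ` arcs G \<longrightarrow> x p = 0}"

definition basis_vec :: "'a + 'b \<Rightarrow> ('a, 'b) vec" where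
  "basis_vec p = (\<lambda>q. if q = p then 1 else 0)"

fun basis_bracket :: "('a, 'b) pre_digraph \<Rightarrow> 'a + 'b \<Rightarrow> 'a + 'b \<Rightarrow> ('a, 'b) vec" where
  "basis_bracket G (Inl u) (Inl v) =
     (if u \<rightarrow>\<^bsub>G\<^esub> v then basis_vec (Inr (THE e. e \<in> arcs G \<and> arc_to_ends G e = (u, v)))
      else if v \<rightarrow>\<^bsub>G\<^esub> u then (\<lambda>r. - basis_vec (Inr (THE e. e \<in> arcs G \<and> arc_to_ends G e = (v, u))) r)
      else (\<lambda>_. 0))"
| "basis_bracket G (Inr _) _ = (\<lambda>_. 0)"
| "basis_bracket G _ (Inr _) = (\<lambda>_. 0)"

definition lie_bracket :: "('a, 'b) pre_digraph \<Rightarrow> ('a, 'b) vec \<Rightarrow> ('a, 'b) vec \<Rightarrow> ('a, 'b) vec" where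
  "lie_bracket G x y =
     (\<lambda>r. \<Sum>p\<in>nG_basis G. \<Sum>q\<in>nG_basis G. x p * y q * basis_bracket G p q r)"

definition nG_inner :: "('a, 'b) pre_digraph \<Rightarrow> ('a, 'b) vec \<Rightarrow> ('a, 'b) vec \<Rightarrow> real" where
  "nG_inner G x y = (\<Sum>p\<in>nG_basis G. x p * y p)"

definition j_map :: "('a, 'b) pre_digraph \<Rightarrow> ('a, 'b) vec \<Rightarrow> ('a, 'b) vec \<Rightarrow> ('a, 'b) vec" where
  "j_map G Z X =
     (THE W. W \<in> vertex_space G \<and>
        (\<forall>Y\<in>vertex_space G. nG_inner G W Y = nG_inner G (lie_bracket G X Y) Z))"

definition nonsingular :: "('a, 'b) pre_digraph \<Rightarrow> bool" where
  "nonsingular G \<longleftrightarrow>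
     (\<forall>Z\<in>edge_space G. Z \<noteq> (\<lambda>_. 0) \<longrightarrow>
        bij_betw (j_map G Z) (vertex_space G) (vertex_space G))"

text \<open>
  In the library, undirected graphs are symmetric digraphs and \<open>K\<^bsub>n\<^esub>\<close> is a predicate on these. So
  forgetting the directions of the edges is \<^const>\<open>mk_symmetric\<close>.
\<close>

definition underlying_K2 :: "('a, 'b) pre_digraph \<Rightarrow> bool" where
  "underlying_K2 G \<longleftrightarrow> K\<^bsub>2\<^esub> (with_proj (mk_symmetric G))"


context simple_directed_graph
begin

lemma finite_nG_basis [simp]: "finite (nG_basis G)"
  by (simp add: nG_basis_def)

lemma basis_vec_in_nG: "p \<in> nG_basis G \<Longrightarrow> basis_vec p \<in> nG G"
  by (auto simp: nG_def basis_vec_def)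

lemma the_arc: "e \<in> arcs G \<Longrightarrow> (THE e'. e' \<in> arcs G \<and> arc_to_ends G e' = (tail G e, head G e)) = e"
  by (rule the_equality) (auto intro: no_multi_arcs simp: arc_to_ends_def)

lemma lie_bracket_basis:
  assumes "p \<in> nG_basis G" "q \<in> nG_basis G"
  shows "lie_bracket G (basis_vec p) (basis_vec q) = basis_bracket G p q"
proof
  fix r
  have "lie_bracket G (basis_vec p) (basis_vec q) r
      = (\<Sum>p'\<in>nG_basis G. \<Sum>q'\<in>nG_basis G. if q' = q then (if p' = p then basis_bracket G p' q' r else 0) else 0)"
    unfolding lie_bracket_def by (intro sum.cong refl) (auto simp: basis_vec_def)
  also have "\<dots> = basis_bracket G p q r"
    using assms by (simp add: sum.delta)
  finally show "lie_bracket G (basis_vec p) (basis_vec q) r = basis_bracket G p q r" .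
qed

lemma lie_bracket_arc:
  assumes "e \<in> arcs G"
  shows "lie_bracket G (basis_vec (Inl (tail G e))) (basis_vec (Inl (head G e))) = basis_vec (Inr e)"
proof -
  have "tail G e \<rightarrow>\<^bsub>G\<^esub> head G e"
    using assms by (auto simp: arcs_ends_conv)
  moreover have "Inl (tail G e) \<in> nG_basis G" "Inl (head G e) \<in> nG_basis G"
    using assms by (auto simp: nG_basis_def)
  ultimately show ?thesis
    using assms by (simp add: lie_bracket_basis the_arc)
qed

lemma basis_bracket_skew: "basis_bracket G p q r = - basis_bracket G q p r"
proof (cases p; cases q)
  fix u v assume "p = Inl u" "q = Inl v"
  then show ?thesis using no_opposite_arcs[of u v] by auto
qed auto

lemma lie_bracket_skew: "lie_bracket G x y r = - lie_bracket G y x r"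
proof -
  have "lie_bracket G x y r = (\<Sum>q\<in>nG_basis G. \<Sum>p\<in>nG_basis G. x p * y q * basis_bracket G p q r)"
    unfolding lie_bracket_def by (rule sum.swap)
  also have "\<dots> = (\<Sum>q\<in>nG_basis G. \<Sum>p\<in>nG_basis G. - (y q * x p * basis_bracket G q p r))"
    by (intro sum.cong refl) (subst basis_bracket_skew, simp)
  finally show ?thesis by (simp add: lie_bracket_def sum_negf)
qed

lemma lie_bracket_add_left:
  "lie_bracket G (\<lambda>p. x p + x' p) y r = lie_bracket G x y r + lie_bracket G x' y r"
  by (simp add: lie_bracket_def sum.distrib algebra_simps)

lemma lie_bracket_scale_left:
  "lie_bracket G (\<lambda>p. c * x p) y r = c * lie_bracket G x y r"
  by (simp add: lie_bracket_def sum_distrib_left algebra_simps)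

lemma lie_bracket_edge_space:
  assumes "z \<in> edge_space G"
  shows "lie_bracket G x z = (\<lambda>_. 0)"
proof
  fix r
  have "x p * z q * basis_bracket G p q r = 0" for p q
    using assms by (cases p; cases q) (auto simp: edge_space_def)
  then show "lie_bracket G x z r = 0"
    unfolding lie_bracket_def by (intro sum.neutral ballI)
qed

lemma basis_bracket_in_edge_space: "basis_bracket G p q \<in> edge_space G"
proof (cases p; cases q)
  fix u v assume "p = Inl u" "q = Inl v"
  then show ?thesis
    by (auto simp: edge_space_def basis_vec_def arcs_ends_conv the_arc)
qed (auto simp: edge_space_def)

lemma lie_bracket_in_edge_space: "lie_bracket G x y \<in> edge_space G"
  using basis_bracket_in_edge_space by (auto simp: edge_space_def lie_bracket_def)

lemma vertex_space_eqI:
  assumes "W \<in> vertex_space G" "W' \<in> vertex_space G"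
    and "\<And>Y. Y \<in> vertex_space G \<Longrightarrow> nG_inner G W Y = nG_inner G W' Y"
  shows "W = W'"
proof
  fix p
  show "W p = W' p"
  proof (cases "p \<in> Inl ` verts G")
    case True
    then have p: "p \<in> nG_basis G" and V: "basis_vec p \<in> vertex_space G"
      by (auto simp: nG_basis_def vertex_space_def basis_vec_def)
    have "nG_inner G U (basis_vec p) = U p" for U
      using p by (simp add: nG_inner_def basis_vec_def if_distrib[of "(*) _"] cong: if_cong)
    then show ?thesis using assms(3)[OF V] by simp
  next
    case False
    then show ?thesis using assms(1,2) by (simp add: vertex_space_def)
  qed
qed

lemma j_map_unique_ex:
  "\<exists>!W. W \<in> vertex_space G \<and>
     (\<forall>Y\<in>vertex_space G. nG_inner G W Y = nG_inner G (lie_bracket G X Y) Z)"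
proof (rule ex_ex1I)
  define W where "W q = (if q \<in> Inl ` verts G
     then (\<Sum>r\<in>nG_basis G. \<Sum>p\<in>nG_basis G. X p * basis_bracket G p q r * Z r) else 0)" for q
  have "nG_inner G W Y = nG_inner G (lie_bracket G X Y) Z" if Y: "Y \<in> vertex_space G" for Y
  proof -
    have "nG_inner G W Y
        = (\<Sum>q\<in>nG_basis G. \<Sum>r\<in>nG_basis G. \<Sum>p\<in>nG_basis G. X p * Y q * basis_bracket G p q r * Z r)"
      unfolding nG_inner_def
    proof (intro sum.cong refl)
      fix q
      show "W q * Y q = (\<Sum>r\<in>nG_basis G. \<Sum>p\<in>nG_basis G. X p * Y q * basis_bracket G p q r * Z r)"
        using Y by (cases "q \<in> Inl ` verts G")
          (simp_all add: W_def vertex_space_def sum_distrib_left sum_distrib_right mult_ac)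
    qed
    also have "\<dots> = (\<Sum>r\<in>nG_basis G. \<Sum>q\<in>nG_basis G. \<Sum>p\<in>nG_basis G. X p * Y q * basis_bracket G p q r * Z r)"
      by (rule sum.swap)
    also have "\<dots> = (\<Sum>r\<in>nG_basis G. \<Sum>p\<in>nG_basis G. \<Sum>q\<in>nG_basis G. X p * Y q * basis_bracket G p q r * Z r)"
      by (rule sum.cong[OF refl]) (rule sum.swap)
    also have "\<dots> = nG_inner G (lie_bracket G X Y) Z"
      by (simp add: nG_inner_def lie_bracket_def sum_distrib_right)
    finally show ?thesis .
  qed
  moreover have "W \<in> vertex_space G" by (simp add: vertex_space_def W_def)
  ultimately show "\<exists>W. W \<in> vertex_space G \<and>
     (\<forall>Y\<in>vertex_space G. nG_inner G W Y = nG_inner G (lie_bracket G X Y) Z)" by blast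
qed (metis vertex_space_eqI)

lemma j_map_in_vertex_space: "j_map G Z X \<in> vertex_space G"
  and inner_j_map:
    "Y \<in> vertex_space G \<Longrightarrow> nG_inner G (j_map G Z X) Y = nG_inner G (lie_bracket G X Y) Z"
  using theI'[OF j_map_unique_ex[of X Z]] unfolding j_map_def by blast+

end

end

theory Submission
  imports Defs
begin

text \<open>
  For an arc \<open>e\<close> from \<open>t\<close> to \<open>h\<close>, the map \<open>j(e)\<close> is the quarter turn \<open>t \<mapsto> h\<close>, \<open>h \<mapsto> -t\<close> of the
  plane spanned by the end points of \<open>e\<close>, and it kills every other vertex (\<open>j_map_single_arc\<close>).
  If \<open>\<nn>\<^sub>G\<close> is nonsingular, then no vertex may lie in the kernel of \<open>j(e)\<close>, so \<open>t\<close> and \<open>h\<close> are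
  the only vertices; a simple directed graph has at most one arc between them, so it is \<open>K\<^sub>2\<close> up to
  direction (\<open>nonsingular_imp_verts\<close>, \<open>underlying_K2_iff_verts\<close>). Conversely, in \<open>K\<^sub>2\<close> the arc \<open>e\<close> spans the edge space, so
  each nonzero \<open>Z\<close> is \<open>c e\<close> with \<open>c \<noteq> 0\<close>; then \<open>j(Z)\<close> is \<open>c\<close> times a quarter turn of the whole vertex
  space, with inverse \<open>j((-1/c) e)\<close>.
\<close>

context simple_directed_graph
begin

text \<open>
  A bracket involves \<open>e\<close> only when its arguments are the two ends of \<open>e\<close>. All parts of simplicity
  enter: without parallel arcs, \<open>e\<close> is the arc that the definite description selects for its ends;
  without loops, the pairs \<open>(tail, head)\<close> and \<open>(head, tail)\<close> differ, so the two signs cannot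
  cancel; without opposite arcs, the pair \<open>(head, tail)\<close> reaches the negative case of the definition.
\<close>

lemma basis_bracket_arc_coord:
  assumes e: "e \<in> arcs G"
  shows "basis_bracket G p q (Inr e) =
    (if p = Inl (tail G e) then if q = Inl (head G e) then 1 else 0 else 0) -
    (if p = Inl (head G e) then if q = Inl (tail G e) then 1 else 0 else 0)"
proof (cases p; cases q)
  fix u v assume pq: "p = Inl u" "q = Inl v"
  have ne: "tail G e \<noteq> head G e"
    using no_loops[OF e] .
  have fwd: "tail G e \<rightarrow>\<^bsub>G\<^esub> head G e"
    using e by (auto simp: arcs_ends_conv)
  have bwd: "\<not> head G e \<rightarrow>\<^bsub>G\<^esub> tail G e"
    using no_opposite_arcs[OF fwd] .
  have the_coord: "basis_vec (Inr (THE e. e \<in> arcs G \<and> arc_to_ends G e = (a, b))) (Inr e) =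
      (if a = tail G e \<and> b = head G e then 1 else 0 :: real)" if "a \<rightarrow>\<^bsub>G\<^esub> b" for a b
  proof -
    from that obtain f where f: "f \<in> arcs G" "a = tail G f" "b = head G f"
      by (auto simp: arcs_ends_conv)
    then have "(THE e. e \<in> arcs G \<and> arc_to_ends G e = (a, b)) = f"
      by (simp add: the_arc)
    moreover have "f = e \<longleftrightarrow> a = tail G e \<and> b = head G e"
      using f e no_multi_arcs[of f e] by (auto simp: arc_to_ends_def)
    ultimately show ?thesis
      by (simp add: basis_vec_def eq_commute)
  qed
  show ?thesis
    using fwd bwd ne pq the_coord[of u v] the_coord[of v u] by auto
qed auto

lemma lie_bracket_arc_coord:
  assumes e: "e \<in> arcs G"
  shows "lie_bracket G X Y (Inr e) =
    X (Inl (tail G e)) * Y (Inl (head G e)) - X (Inl (head G e)) * Y (Inl (tail G e))"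
proof -
  have "Inl (tail G e) \<in> nG_basis G" "Inl (head G e) \<in> nG_basis G"
    using e by (auto simp: nG_basis_def)
  moreover have "(\<Sum>p\<in>nG_basis G. \<Sum>q\<in>nG_basis G. X p * Y q *
      (if p = a then if q = b then 1 else 0 else 0)) = X a * Y b"
    if "a \<in> nG_basis G" "b \<in> nG_basis G" for a b
  proof -
    have "(\<Sum>p\<in>nG_basis G. \<Sum>q\<in>nG_basis G. X p * Y q * (if p = a then if q = b then 1 else 0 else 0))
        = (\<Sum>p\<in>nG_basis G. \<Sum>q\<in>nG_basis G. if q = b then (if p = a then X p * Y q else 0) else 0)"
      by (intro sum.cong refl) auto
    also have "\<dots> = X a * Y b"
      using that by simp
    finally show ?thesis .
  qed
  ultimately show ?thesis
    by (simp only: lie_bracket_def basis_bracket_arc_coord[OF e] right_diff_distrib sum_subtractf)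
qed

text \<open>
  The inner product of \<open>[X, Y]\<close> with \<open>c e\<close> only sees the coordinate of \<open>[X, Y]\<close> at \<open>e\<close>, which is the
  oriented area spanned by \<open>X\<close> and \<open>Y\<close> in the plane of the ends of \<open>e\<close>. So \<open>j(c e)\<close> projects to that
  plane, turns it by a right angle and scales by \<open>c\<close>.
\<close>

lemma j_map_single_arc:
  assumes e: "e \<in> arcs G"
  shows "j_map G (\<lambda>p. c * basis_vec (Inr e) p) X =
    (\<lambda>p. c * (X (Inl (tail G e)) * basis_vec (Inl (head G e)) p
            - X (Inl (head G e)) * basis_vec (Inl (tail G e)) p))"
    (is "_ = ?W")
proof (rule vertex_space_eqI)
  show "?W \<in> vertex_space G"
    using e by (auto simp: vertex_space_def basis_vec_def)
next
  fix Y assume Y: "Y \<in> vertex_space G"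
  have basis: "Inr e \<in> nG_basis G" "Inl (tail G e) \<in> nG_basis G" "Inl (head G e) \<in> nG_basis G"
    using e by (auto simp: nG_basis_def)
  have coord: "(\<Sum>p\<in>nG_basis G. f p * basis_vec a p) = f a" if "a \<in> nG_basis G" for f a
    using that by (simp add: basis_vec_def if_distrib[of "(*) _"] cong: if_cong)
  have "nG_inner G (j_map G (\<lambda>p. c * basis_vec (Inr e) p) X) Y
      = nG_inner G (lie_bracket G X Y) (\<lambda>p. c * basis_vec (Inr e) p)"
    by (rule inner_j_map[OF Y])
  also have "\<dots> = lie_bracket G X Y (Inr e) * c"
    using coord[OF basis(1), of "\<lambda>p. lie_bracket G X Y p * c"]
    by (simp add: nG_inner_def mult.assoc)
  also have "\<dots> = nG_inner G ?W Y"
    using coord[OF basis(3), of "\<lambda>p. c * X (Inl (tail G e)) * Y p"]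
      coord[OF basis(2), of "\<lambda>p. c * X (Inl (head G e)) * Y p"]
    by (simp add: nG_inner_def lie_bracket_arc_coord[OF e] algebra_simps sum_subtractf)
  finally show "nG_inner G (j_map G (\<lambda>p. c * basis_vec (Inr e) p) X) Y = nG_inner G ?W Y" .
qed (rule j_map_in_vertex_space)

lemma arcs_eq_singleton:
  assumes e: "e \<in> arcs G" and V: "verts G = {tail G e, head G e}"
  shows "arcs G = {e}"
proof -
  have "f = e" if f: "f \<in> arcs G" for f
  proof -
    have "tail G f \<in> {tail G e, head G e}" "head G f \<in> {tail G e, head G e}"
      using wellformed[OF f] unfolding V by blast+
    moreover have "tail G f \<noteq> head G f"
      using no_loops[OF f] .
    moreover have "\<not> (tail G f = head G e \<and> head G f = tail G e)"
      using no_opposite_arcs[OF in_arcs_imp_in_arcs_ends[OF e]] in_arcs_imp_in_arcs_ends[OF f] by auto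
    ultimately have "arc_to_ends G f = arc_to_ends G e"
      by (auto simp: arc_to_ends_def)
    then show "f = e"
      using e f no_multi_arcs by blast
  qed
  with e show ?thesis by blast
qed

lemma underlying_K2_iff_verts:
  assumes e: "e \<in> arcs G"
  shows "underlying_K2 G \<longleftrightarrow> verts G = {tail G e, head G e}"
proof -
  have ends: "{tail G e, head G e} \<subseteq> verts G" and card_ends: "card {tail G e, head G e} = 2"
    using wellformed[OF e] no_loops[OF e] by auto
  show ?thesis
  proof
    assume "underlying_K2 G"
    then have "card (verts G) = 2"
      by (simp add: underlying_K2_def complete_digraph_pair_def)
    then show "verts G = {tail G e, head G e}"
      using card_subset_eq[OF finite_verts ends] card_ends by simp
  next
    assume V: "verts G = {tail G e, head G e}"
    show "underlying_K2 G"
      using card_ends no_loops[OF e] arcs_eq_singleton[OF e V]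
      by (auto simp: underlying_K2_def complete_digraph_pair_def parcs_mk_symmetric V)
  qed
qed

text \<open>A vertex off \<open>e\<close> would lie in the kernel of \<open>j(e)\<close>.\<close>

lemma nonsingular_imp_verts:
  assumes ns: "nonsingular G" and e: "e \<in> arcs G"
  shows "verts G = {tail G e, head G e}"
proof -
  \<comment> \<open>The factor 1 brings \<open>e\<close> into the form \<open>c e\<close> of \<open>j_map_single_arc\<close>.\<close>
  let ?Z = "\<lambda>p. 1 * basis_vec (Inr e) p"
  have "?Z \<in> edge_space G" "?Z \<noteq> (\<lambda>_. 0)"
    using e by (auto simp: edge_space_def basis_vec_def fun_eq_iff)
  then have inj: "inj_on (j_map G ?Z) (vertex_space G)"
    using ns unfolding nonsingular_def bij_betw_def by blast
  have "w \<in> {tail G e, head G e}" if w: "w \<in> verts G" for w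
  proof (rule ccontr)
    assume "w \<notin> {tail G e, head G e}"
    then have "j_map G ?Z (basis_vec (Inl w)) = j_map G ?Z (\<lambda>_. 0)"
      unfolding j_map_single_arc[OF e] by (auto simp: basis_vec_def)
    moreover have "(basis_vec (Inl w) :: ('a, 'b) vec) \<in> vertex_space G" "(\<lambda>_. 0) \<in> vertex_space G"
      using w by (auto simp: vertex_space_def basis_vec_def)
    ultimately have "(basis_vec (Inl w) :: ('a, 'b) vec) = (\<lambda>_. 0)"
      by (rule inj_onD[OF inj])
    from fun_cong[OF this, of "Inl w"] show False
      by (simp add: basis_vec_def)
  qed
  then show ?thesis
    using wellformed[OF e] by blast
qed

text \<open>
  When the ends of \<open>e\<close> are all vertices, the edge space is the line spanned by \<open>e\<close>, and the plane
  turned by \<open>j(c e)\<close> is the whole vertex space.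
\<close>

lemma verts_imp_nonsingular:
  assumes e: "e \<in> arcs G" and V: "verts G = {tail G e, head G e}"
  shows "nonsingular G"
  unfolding nonsingular_def
proof (intro ballI impI)
  fix Z assume Z: "Z \<in> edge_space G" "Z \<noteq> (\<lambda>_. 0)"
  define c where "c = Z (Inr e)"
  have Z_eq: "Z = (\<lambda>p. c * basis_vec (Inr e) p)"
    using Z(1) arcs_eq_singleton[OF e V] by (auto simp: edge_space_def basis_vec_def c_def)
  then have c: "c \<noteq> 0"
    using Z(2) by auto
  have ne: "tail G e \<noteq> head G e"
    using no_loops[OF e] .
  let ?j = "\<lambda>a. j_map G (\<lambda>p. a * basis_vec (Inr e) p)"
  \<comment> \<open>A quarter turn squares to \<open>-1\<close>.\<close>
  have compose: "?j a (?j b X) = X" if ab: "a * b = -1" and X: "X \<in> vertex_space G" for a b X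
  proof
    fix p
    show "?j a (?j b X) p = X p"
    proof (cases "p \<in> {Inl (tail G e), Inl (head G e)}")
      case True
      have "a * (b * y) = - y" for y
        using ab by (simp flip: mult.assoc)
      with True ne show ?thesis
        unfolding j_map_single_arc[OF e] by (auto simp: basis_vec_def)
    next
      case False
      then show ?thesis
        using X unfolding j_map_single_arc[OF e] by (auto simp: basis_vec_def vertex_space_def V)
    qed
  qed
  define d where "d = - 1 / c"
  have "c * d = -1" "d * c = -1"
    using c by (simp_all add: d_def)
  then show "bij_betw (j_map G Z) (vertex_space G) (vertex_space G)"
    unfolding Z_eq
    by (intro bij_betw_byWitness[where f' = "?j d"])
      (auto intro!: compose j_map_in_vertex_space)
qed

end

theorem lemma3p3:
  fixes G :: "('a, 'b) pre_digraph"
  assumes "simple_directed_graph G"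
    and "arcs G \<noteq> {}"
  shows "nonsingular G \<longleftrightarrow> underlying_K2 G"
proof -
  interpret simple_directed_graph G by fact
  obtain e where e: "e \<in> arcs G"
    using assms(2) by blast
  show ?thesis
    using nonsingular_imp_verts[OF _ e] verts_imp_nonsingular[OF e] underlying_K2_iff_verts[OF e]
    by blast
qed

end
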